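(* Let $t_n$ be the number of dependency trees with exactly $n$ nodes. Then, as $n\to\infty$, $$t_n\sim\frac{1}{\sqrt{27\pi}\,n^{3/2}}\left(\frac{27}{4}\right)^n,$$ i.e. the ratio of the two sides tends to $1$.
   Context: A dependency tree is defined recursively: it consists of a root node together with a finite (possibly empty) ordered sequence of dependency trees on the left of the root and a finite (possibly empty) ordered sequence of dependency trees on the right of the root (both sequences being empty gives the single-node tree). Equivalently, the class $\mathcal{T}$ of dependency trees satisfies $\mathcal{T}=\mathrm{SEQ}(\mathcal{T})\times\circ\times\mathrm{SEQ}(\mathcal{T})$, where $\circ$ is the root node (of size 1), $\times$ is the class of ordered pairs, and $\mathrm{SEQ}(\mathcal{A})$ is the class of finite sequences (including the empty one) of elements of $\mathcal{A}$. Nodes are unlabelled; two dependency trees are equal exactly when their left sequences coincide and their right sequences coincide. The size of a tree is its total number of nodes. *)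

theory Defs
  imports "HOL-Analysis.Analysis" "HOL-Library.Landau_Symbols"
begin

datatype dep_tree = Node (left_trees: "dep_tree list") (right_trees: "dep_tree list")

(* The automatically generated size function of the datatype also counts list cells,
   so the number of nodes is defined separately. *)
primrec num_nodes :: "dep_tree \<Rightarrow> nat" where
  "num_nodes (Node ls rs) = 1 + sum_list (map num_nodes ls) + sum_list (map num_nodes rs)"

definition dep_tree_count :: "nat \<Rightarrow> nat" where
  "dep_tree_count n = card {t. num_nodes t = n}"

lemma num_nodes_pos: "num_nodes t > 0"
  by (cases t) simp

lemma length_le_sum_num_nodes: "length ts \<le> sum_list (map num_nodes ts)"
proof (induction ts)
  case (Cons t ts)
  then show ?case using num_nodes_pos[of t] by simp
qed simp

(* The cardinality above is that of a finite set. *)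
lemma finite_num_nodes_le: "finite {t. num_nodes t \<le> n}"
proof (induction n)
  case 0
  have "{t. num_nodes t \<le> 0} = {}" using num_nodes_pos by (auto simp: not_le)
  then show ?case by (metis finite.emptyI)
next
  case (Suc n)
  define L where "L = {ts. set ts \<subseteq> {t. num_nodes t \<le> n} \<and> length ts \<le> n}"
  have fin: "finite L"
    unfolding L_def using finite_lists_length_le[OF Suc.IH] .
  have in_L: "ts \<in> L" if "sum_list (map num_nodes ts) \<le> n" for ts
  proof -
    have "num_nodes t \<le> n" if "t \<in> set ts" for t
      using member_le_sum_list[of "num_nodes t" "map num_nodes ts"] that
        \<open>sum_list (map num_nodes ts) \<le> n\<close> by auto
    then show ?thesis
      using that length_le_sum_num_nodes[of ts] by (auto simp: L_def)
  qed
  have "{t. num_nodes t \<le> Suc n} \<subseteq> (\<lambda>(ls, rs). Node ls rs) ` (L \<times> L)"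
  proof
    fix t assume "t \<in> {t. num_nodes t \<le> Suc n}"
    then show "t \<in> (\<lambda>(ls, rs). Node ls rs) ` (L \<times> L)"
      by (cases t) (auto simp: image_iff intro!: in_L)
  qed
  then show ?case using fin by (meson finite_SigmaI finite_imageI finite_subset)
qed

lemma finite_num_nodes_eq: "finite {t. num_nodes t = n}"
  by (rule finite_subset[OF _ finite_num_nodes_le[of n]]) auto

end

theory Submission
  imports Defs
begin

text \<open>Call an \<open>r\<close>-tuple of tree sequences with \<open>n\<close> nodes in total a configuration. A configuration
  either begins with an empty sequence, which can be dropped, or begins with a tree, whose root
  can be deleted, leaving an \<open>(r + 2)\<close>-tuple with one node less. The resulting recurrence is
  Pascal's rule for the ballot-type numbers
  \<open>(3n + r - 1) choose n - 2 * ((3n + r - 1) choose (n - 1))\<close>, and a tree with \<open>n + 1\<close> nodes is a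
  pair of sequences with \<open>n\<close> nodes, so \<open>3 (3n - 1) t\<^sub>n = 2 (3n choose n)\<close>. Splitting the factorials by
  residue classes turns the binomial coefficient into a quotient of Pochhammer symbols at
  \<open>1/3\<close>, \<open>2/3\<close> and \<open>1/2\<close>; Euler's limit for the Gamma function and the reflection formula
  replace Stirling's formula.\<close>

subsection \<open>Counting tuples of tree sequences\<close>

definition forest_nodes :: "dep_tree list \<Rightarrow> nat" where
  "forest_nodes ts = sum_list (map num_nodes ts)"

definition forest_tuples :: "nat \<Rightarrow> nat \<Rightarrow> dep_tree list list set" where
  "forest_tuples r n = {xs. length xs = r \<and> sum_list (map forest_nodes xs) = n}"

text \<open>The inverse of deleting the root of the first tree. The last clause is only a default:
  \<open>graft\<close> is applied to tuples of length at least 3.\<close>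

fun graft :: "dep_tree list list \<Rightarrow> dep_tree list list" where
  "graft (ls # rs # ts # xs) = (Node ls rs # ts) # xs"
| "graft xs = xs"

lemma forest_nodes_simps [simp]:
  "forest_nodes [] = 0"
  "forest_nodes (t # ts) = num_nodes t + forest_nodes ts"
  by (simp_all add: forest_nodes_def)

lemma num_nodes_Node: "num_nodes (Node ls rs) = Suc (forest_nodes ls + forest_nodes rs)"
  by (simp add: forest_nodes_def)

lemma forest_nodes_eq_0_iff: "forest_nodes ts = 0 \<longleftrightarrow> ts = []"
  using num_nodes_pos by (cases ts) auto

lemma length_3_plus_E:
  assumes "length xs = r + 3"
  obtains a b c ys where "xs = a # b # c # ys" "length ys = r"
  using assms by (auto simp: eval_nat_numeral length_Suc_conv)

lemma forest_tuples_0_nodes: "forest_tuples r 0 = {replicate r []}"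
proof -
  have "xs = replicate (length xs) []" if "\<forall>x\<in>set xs. x = []" for xs :: "dep_tree list list"
    using that by (induction xs) auto
  then show ?thesis
    by (auto simp: forest_tuples_def forest_nodes_eq_0_iff)
qed

lemma forest_tuples_0_forests: "forest_tuples 0 (Suc n) = {}"
  by (auto simp: forest_tuples_def)

lemma forest_tuples_Suc:
  "forest_tuples (Suc r) (Suc n) = (#) [] ` forest_tuples r (Suc n) \<union> graft ` forest_tuples (r + 3) n"
  (is "?L = ?A \<union> ?B")
proof (intro equalityI subsetI)
  fix xs assume "xs \<in> ?L"
  then obtain y ys where xs: "xs = y # ys" "length ys = r"
      "forest_nodes y + sum_list (map forest_nodes ys) = Suc n"
    by (cases xs) (auto simp: forest_tuples_def)
  show "xs \<in> ?A \<union> ?B"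
  proof (cases y)
    case Nil
    then show ?thesis using xs by (auto simp: forest_tuples_def)
  next
    case (Cons t ts)
    obtain ls rs where t: "t = Node ls rs" by (cases t)
    have "xs = graft (ls # rs # ts # ys)" using xs Cons t by simp
    moreover have "ls # rs # ts # ys \<in> forest_tuples (r + 3) n"
      using xs Cons t by (simp add: forest_tuples_def num_nodes_Node del: num_nodes.simps)
    ultimately show ?thesis by blast
  qed
next
  fix xs assume "xs \<in> ?A \<union> ?B"
  then show "xs \<in> ?L"
    by (auto simp: forest_tuples_def num_nodes_Node simp del: num_nodes.simps elim!: length_3_plus_E)
qed

lemma inj_on_graft: "inj_on graft (forest_tuples (r + 3) n)"
proof (rule inj_onI)
  fix xs ys assume "xs \<in> forest_tuples (r + 3) n" "ys \<in> forest_tuples (r + 3) n"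
    and eq: "graft xs = graft ys"
  then have "length xs = r + 3" "length ys = r + 3"
    by (simp_all add: forest_tuples_def)
  with eq show "xs = ys"
    by (elim length_3_plus_E) simp
qed

text \<open>The recurrence lengthens the tuple only when it removes a node, so the outer induction
  is on \<open>n\<close> with \<open>r\<close> arbitrary and the inner one on
  \<open>r\<close>.\<close>

lemma finite_forest_tuples: "finite (forest_tuples r n)"
proof (induction n arbitrary: r)
  case 0
  show ?case by (simp add: forest_tuples_0_nodes)
next
  case (Suc n)
  show ?case
    by (induction r) (use Suc in \<open>auto simp: forest_tuples_0_forests forest_tuples_Suc\<close>)
qed

lemma card_forest_tuples_Suc:
  "card (forest_tuples (Suc r) (Suc n)) = card (forest_tuples r (Suc n)) + card (forest_tuples (r + 3) n)"
proof -
  \<comment> \<open>A grafted tuple starts with a nonempty sequence.\<close>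
  have "(#) [] ` forest_tuples r (Suc n) \<inter> graft ` forest_tuples (r + 3) n = {}"
    by (auto simp: forest_tuples_def elim!: length_3_plus_E)
  then show ?thesis
    by (simp add: forest_tuples_Suc card_Un_disjoint finite_forest_tuples card_image inj_on_graft)
qed

lemma card_forest_tuples:
  "card (forest_tuples r (Suc n)) + 2 * ((3 * n + r + 2) choose n) = (3 * n + r + 2) choose (Suc n)"
proof (induction n arbitrary: r)
  case 0
  show ?case
  proof (induction r)
    case (Suc r)
    then show ?case
      using card_forest_tuples_Suc[of r 0] by (simp add: forest_tuples_0_nodes)
  qed (simp add: forest_tuples_0_forests)
next
  case (Suc n)
  show ?case
  proof (induction r)
    case 0
    \<comment> \<open>No empty tuple has nodes, so the two binomial terms must cancel: consecutive
      binomials in row \<open>N\<close> have ratio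
      \<open>(N - (n + 1)) / (n + 2) = 2\<close>.\<close>
    define N where "N = 3 * n + 5"
    have "Suc (Suc n) * (N choose Suc (Suc n)) = (N - Suc n) * (N choose Suc n)"
      by (simp only: binomial_absorb_comp binomial_absorption)
    also have "N - Suc n = Suc (Suc n) * 2"
      by (simp add: N_def)
    finally have "N choose Suc (Suc n) = 2 * (N choose Suc n)"
      by (metis mult.assoc mult_cancel1 nat.distinct(1))
    moreover have "3 * Suc n + 0 + 2 = N"
      by (simp add: N_def)
    ultimately show ?case
      by (simp only: forest_tuples_0_forests card.empty add_0)
  next
    case (Suc r)
    \<comment> \<open>Both induction hypotheses live in row \<open>N\<close> and the goal in row
      \<open>N + 1\<close>; adding the hypotheses is Pascal's rule in each binomial.\<close>
    define N where "N = 3 * n + r + 5"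
    have eqs: "3 * Suc n + r + 2 = N" "3 * Suc n + Suc r + 2 = Suc N" "3 * n + (r + 3) + 2 = N"
      by (simp_all add: N_def)
    show ?case
      using Suc.IH \<open>\<And>r. card (forest_tuples r (Suc n)) + _ = _\<close>[of "r + 3"]
      unfolding eqs card_forest_tuples_Suc by simp
  qed
qed

section \<open>Closed form for the number of trees\<close>

lemma dep_tree_count_Suc: "dep_tree_count (Suc n) = card (forest_tuples 2 n)"
proof -
  have "bij_betw (\<lambda>t. [left_trees t, right_trees t]) {t. num_nodes t = Suc n} (forest_tuples 2 n)"
  proof (rule bij_betw_byWitness[where f' = "\<lambda>xs. Node (xs ! 0) (xs ! 1)"])
    show "(\<lambda>t. [left_trees t, right_trees t]) ` {t. num_nodes t = Suc n} \<subseteq> forest_tuples 2 n"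
    proof (clarify)
      fix t assume "num_nodes t = Suc n"
      then show "[left_trees t, right_trees t] \<in> forest_tuples 2 n"
        by (cases t) (simp add: forest_tuples_def num_nodes_Node del: num_nodes.simps)
    qed
  qed (auto simp: forest_tuples_def num_nodes_Node eval_nat_numeral length_Suc_conv
            simp del: num_nodes.simps)
  then show ?thesis
    unfolding dep_tree_count_def by (rule bij_betw_same_card)
qed

lemma dep_tree_count_closed_form:
  assumes "n > 0"
  shows "real (dep_tree_count n) = 2 / (3 * (3 * real n - 1)) * real (3 * n choose n)"
proof -
  \<comment> \<open>\<open>card_forest_tuples\<close> needs a node besides the root, so the
    single-node tree is treated apart.\<close>
  consider "n = 1" | m where "n = Suc (Suc m)"
    using assms by (metis One_nat_def gr0_conv_Suc not0_implies_Suc)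
  then show ?thesis
  proof cases
    case 1
    then show ?thesis
      by (simp add: dep_tree_count_Suc forest_tuples_0_nodes)
  next
    case 2
    have "real (card (forest_tuples 2 (Suc m))) =
        real ((3 * m + 4) choose Suc m) - 2 * real ((3 * m + 4) choose m)"
    proof -
      have "3 * m + 2 + 2 = 3 * m + 4" by simp
      then show ?thesis
        using card_forest_tuples[of 2 m] by (simp only:)
    qed
    \<comment> \<open>Every factorial is reduced to those of \<open>3 * m + 4\<close>,
      \<open>m\<close> and \<open>2 * m + 3\<close>, which leaves an identity of rational
      functions.\<close>
    moreover have "real ((3 * m + 4) choose m) = fact (3 * m + 4) / (fact m * fact (2 * m + 4))"
      by (subst binomial_fact) (auto simp: algebra_simps)
    moreover have "real ((3 * m + 4) choose Suc m) = fact (3 * m + 4) / (fact (Suc m) * fact (2 * m + 3))"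
      by (subst binomial_fact) (auto simp: algebra_simps eval_nat_numeral)
    moreover have "real (3 * n choose n) = fact (3 * m + 6) / (fact (m + 2) * fact (2 * m + 4))"
      using 2 by (subst binomial_fact) (auto simp: algebra_simps)
    moreover have "fact (3 * m + 6) = (3 * real m + 6) * (3 * real m + 5) * fact (3 * m + 4)"
      by (simp add: eval_nat_numeral algebra_simps)
    moreover have "fact (2 * m + 4) = (2 * real m + 4) * fact (2 * m + 3)"
      by (simp add: eval_nat_numeral algebra_simps)
    moreover have "fact (m + 2) = (real m + 2) * (real m + 1) * fact m"
      by (simp add: eval_nat_numeral algebra_simps)
    moreover have "fact (Suc m) = (real m + 1) * fact m"
      by simp
    ultimately have "real (card (forest_tuples 2 (Suc m))) =
        fact (3 * m + 4) / ((real m + 1) * fact m * fact (2 * m + 3))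
        - 2 * (fact (3 * m + 4) / (fact m * ((2 * real m + 4) * fact (2 * m + 3))))"
      and "real (3 * n choose n) = (3 * real m + 6) * (3 * real m + 5) * fact (3 * m + 4) /
        ((real m + 2) * (real m + 1) * fact m * ((2 * real m + 4) * fact (2 * m + 3)))"
      by (simp_all only:)
    moreover have "a / ((x + 1) * b * c) - 2 * (a / (b * ((2 * x + 4) * c))) =
        2 / (3 * (3 * (x + 2) - 1)) *
        ((3 * x + 6) * (3 * x + 5) * a / ((x + 2) * (x + 1) * b * ((2 * x + 4) * c)))"
      if "x \<ge> 0" "b > 0" "c > 0" for a b c x :: real
    proof -
      \<comment> \<open>The left-hand side is a multiple of
        \<open>1 / u - 1 / v = (v - u) / (u * v)\<close> with \<open>v - u = 1\<close>; on the right
        \<open>w\<close> cancels.\<close>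
      define u v w where "u = x + 1" and "v = x + 2" and "w = 3 * x + 5"
      have pos: "u > 0" "v > 0" "w > 0" and "v - u = 1"
        using that by (simp_all add: u_def v_def w_def)
      have "a / (u * b * c) - 2 * (a / (b * (2 * v * c))) = a * (v - u) / (u * b * c * v)"
        using pos that(2,3) by (simp add: field_simps)
      also have "\<dots> = 2 / (3 * w) * (3 * v * w * a / (v * u * b * (2 * v * c)))"
        using pos that(2,3) \<open>v - u = 1\<close> by simp
      finally have eq: "a / (u * b * c) - 2 * (a / (b * (2 * v * c))) =
          2 / (3 * w) * (3 * v * w * a / (v * u * b * (2 * v * c)))" .
      have subst: "2 * x + 4 = 2 * v" "3 * x + 6 = 3 * v" "3 * (x + 2) - 1 = w"
        by (simp_all add: v_def w_def)
      show ?thesis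
        unfolding subst using eq unfolding u_def v_def w_def .
    qed
    ultimately show ?thesis
      using 2 by (simp add: dep_tree_count_Suc)
  qed
qed

subsection \<open>Asymptotics\<close>

text \<open>Taking a factor 3 out of each of \<open>3k\<close>, \<open>3k - 2\<close> and
  \<open>3k - 1\<close> for \<open>k = 1, ..., n\<close> leaves \<open>fact n\<close> and the two
  Pochhammer symbols.\<close>

lemma fact_triple:
  "fact (3 * n) = (27 ^ n * fact n * pochhammer (1 / 3) n * pochhammer (2 / 3) n :: real)"
proof (induction n)
  case (Suc n)
  have "fact (3 * Suc n) = (real (3 * n + 3) * real (3 * n + 2) * real (3 * n + 1)) * fact (3 * n)"
    by (simp add: eval_nat_numeral algebra_simps)
  also have "real (3 * n + 3) * real (3 * n + 2) * real (3 * n + 1)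
      = 27 * (real n + 1) * (1 / 3 + real n) * (2 / 3 + real n)"
    by (simp add: algebra_simps)
  finally show ?case
    unfolding Suc.IH pochhammer_Suc by simp
qed simp

text \<open>\<open>Gamma_series' z n\<close> is
  \<open>fact (n - 1) * n powr z / pochhammer z n\<close>, with limit \<open>Gamma z\<close>. The
  identity is exact and isolates all growth in the first factor: the powers of \<open>n\<close> in
  the quotient give \<open>1 / sqrt n\<close>, and the surviving
  \<open>1 / fact (n - 1) = n / fact n\<close> turns this into \<open>sqrt n\<close>.\<close>

lemma choose_triple_Gamma_series':
  assumes "n > 0"
  shows "real (3 * n choose n) = (27 / 4) ^ n / sqrt (real n) *
     (Gamma_series' (1 / 2) n / (Gamma_series' (1 / 3) n * Gamma_series' (2 / 3) n))"
proof -
  have pos: "pochhammer (1 / 2) n > (0::real)" "pochhammer (1 / 3) n > (0::real)"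
      "pochhammer (2 / 3) n > (0::real)"
    by (simp_all add: pochhammer_pos)
  have "exp (1 / 3 * ln (real n)) * exp (2 / 3 * ln (real n)) = real n"
    using assms by (simp flip: exp_add)
  moreover have "exp (1 / 2 * ln (real n)) = sqrt (real n)"
    using assms by (simp add: powr_def flip: powr_half_sqrt)
  moreover have "fact n = real n * fact (n - 1)"
    using assms by (simp add: fact_reduce)
  moreover have "sqrt (real n) * sqrt (real n) = real n" "sqrt (real n) > 0"
    using assms by simp_all
  ultimately have "Gamma_series' (1 / 2) n / (Gamma_series' (1 / 3) n * Gamma_series' (2 / 3) n)
      = sqrt (real n) * pochhammer (1 / 3) n * pochhammer (2 / 3) n / (fact n * pochhammer (1 / 2) n)"
    using pos assms unfolding Gamma_series'_def
    by (simp add: field_simps)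
  moreover have "real (3 * n choose n) =
      (27 / 4) ^ n * pochhammer (1 / 3) n * pochhammer (2 / 3) n / (fact n * pochhammer (1 / 2) n)"
  proof -
    have "fact (2 * n) = 4 ^ n * pochhammer (1 / 2) n * (fact n :: real)"
      by (simp add: fact_double power_mult)
    then have "real (3 * n choose n) =
        27 ^ n * fact n * pochhammer (1 / 3) n * pochhammer (2 / 3) n /
        (fact n * (4 ^ n * pochhammer (1 / 2) n * fact n))"
      by (simp add: binomial_fact fact_triple)
    then show ?thesis
      by (simp add: power_divide mult_ac)
  qed
  ultimately show ?thesis
    using \<open>sqrt (real n) > 0\<close> by simp
qed

text \<open>Reflection formula at \<open>1 / 3\<close>, applied over the complex numbers, with
  \<open>sin (pi / 3) = sqrt 3 / 2\<close>.\<close>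

lemma Gamma_third_mult_two_thirds: "Gamma (1 / 3 :: real) * Gamma (2 / 3) = 2 * pi / sqrt 3"
proof -
  have "complex_of_real (Gamma (1 / 3) * Gamma (2 / 3)) = Gamma (1 / 3) * Gamma (1 - 1 / 3)"
    by (simp flip: Gamma_complex_of_real)
  also have "\<dots> = of_real pi / sin (of_real pi * (1 / 3))"
    by (rule Gamma_reflection_complex)
  also have "sin (of_real pi * (1 / 3)) = complex_of_real (sin (pi / 3))"
    by (simp flip: sin_of_real)
  finally show ?thesis
    by (simp add: sin_60 flip: of_real_divide del: of_real_mult)
qed

theorem mainTheorem3:
  shows "(\<lambda>n::nat. real (dep_tree_count n))
           \<sim>[at_top] (\<lambda>n. 1 / (sqrt (27 * pi) * real n powr (3/2)) * (27/4) ^ n)"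
proof (rule asymp_equivI')
  define q where "q = (\<lambda>n. Gamma_series' (1 / 2 :: real) n /
    (Gamma_series' (1 / 3) n * Gamma_series' (2 / 3) n))"
  have "q \<longlonglongrightarrow> Gamma (1 / 2) / (Gamma (1 / 3) * Gamma (2 / 3))"
    unfolding q_def by (intro tendsto_intros Gamma_series'_LIMSEQ)
      (simp add: Gamma_third_mult_two_thirds)
  \<comment> \<open>This is the denominator \<open>3 * n - 1\<close> of the closed form divided by
    \<open>n\<close>; that \<open>n\<close> and the \<open>sqrt n\<close> of the binomial make up
    \<open>n powr (3/2)\<close>.\<close>
  moreover have "(\<lambda>n. 3 - 1 / real n) \<longlonglongrightarrow> 3 - 0"
    by (intro tendsto_intros lim_1_over_n)
  ultimately have "(\<lambda>n. 2 / 3 * sqrt (27 * pi) * (q n / (3 - 1 / real n)))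
      \<longlonglongrightarrow> 2 / 3 * sqrt (27 * pi) * (Gamma (1 / 2) / (Gamma (1 / 3) * Gamma (2 / 3)) / (3 - 0))"
    by (intro tendsto_intros) auto
  \<comment> \<open>With \<open>Gamma (1 / 2) = sqrt pi\<close> the Gamma quotient is
    \<open>sqrt 3 / (2 * sqrt pi)\<close>, and \<open>sqrt 27 = 3 * sqrt 3\<close>.\<close>
  also have "2 / 3 * sqrt (27 * pi) * (Gamma (1 / 2) / (Gamma (1 / 3) * Gamma (2 / 3)) / (3 - 0)) = 1"
  proof -
    have "sqrt 27 = sqrt (3 ^ 2 * 3)" by simp
    also have "\<dots> = 3 * sqrt 3" by (subst real_sqrt_mult) simp
    finally show ?thesis
      by (simp add: Gamma_third_mult_two_thirds Gamma_one_half_real real_sqrt_mult field_simps)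
  qed
  finally show "(\<lambda>n. real (dep_tree_count n) /
      (1 / (sqrt (27 * pi) * real n powr (3/2)) * (27/4) ^ n)) \<longlonglongrightarrow> 1"
  proof (rule Lim_transform_eventually)
    show "\<forall>\<^sub>F n in sequentially. 2 / 3 * sqrt (27 * pi) * (q n / (3 - 1 / real n)) =
        real (dep_tree_count n) / (1 / (sqrt (27 * pi) * real n powr (3/2)) * (27/4) ^ n)"
      using eventually_gt_at_top[of 0]
    proof eventually_elim
      case (elim n)
      have "real n powr (3 / 2) = real n powr 1 * real n powr (1 / 2)"
        by (subst powr_add[symmetric]) simp
      then have "real n powr (3 / 2) = real n * sqrt (real n)"
        using elim by (simp add: powr_half_sqrt)
      moreover have "3 - 1 / real n = (3 * real n - 1) / real n" "3 * real n - 1 > 0"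
        using elim by (simp_all add: field_simps)
      moreover have "real (dep_tree_count n) =
          2 / (3 * (3 * real n - 1)) * ((27 / 4) ^ n / sqrt (real n) * q n)"
        using elim by (simp only: dep_tree_count_closed_form choose_triple_Gamma_series' q_def)
      ultimately show ?case
        using elim by simp
    qed
  qed
qed

end
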